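(* Let $n\geq 1$ be an integer. Then \[ \dim_F \mathrm{Bad}(n)\leq \frac{2n}{n+1}. \]
   Context: For a Borel probability measure $\mu$ on $\mathbb{R}^n$, $\hat\mu(\xi)=\int e^{-2\pi i x\cdot\xi}\,d\mu(x)$ and $\dim_F\mu=\sup\{s\in[0,n]: |\hat\mu(\xi)|\ll|\xi|^{-s/2}\}$. For $E\subset\mathbb{R}^n$, $\dim_F E=\sup\{\dim_F\mu:\mu\in\mathcal P(E)\}$, where $\mathcal P(E)$ is the set of Borel probability measures on $\mathbb{R}^n$ whose support is a compact subset of $E$. For $x\in\mathbb{R}^n$, $\|x\|$ denotes the Euclidean distance from $x$ to the nearest point of $\mathbb{Z}^n$. The set of badly approximable vectors is \[ \mathrm{Bad}(n)=\{x\in\mathbb{R}^n:\exists c(x)>0\ \forall q\in\mathbb{N},\ \|qx\|\geq c(x)q^{-1/n}\}. \] *)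

theory Defs
  imports "HOL-Probability.Probability"
begin

definition fourier_transform :: "(real ^ 'n) measure \<Rightarrow> real ^ 'n \<Rightarrow> complex" where
  "fourier_transform \<mu> \<xi> =
     (\<integral>x. exp (- 2 * complex_of_real pi * \<i> * complex_of_real (x \<bullet> \<xi>)) \<partial>\<mu>)"

(* The frequency \<xi> = 0 is excluded because 0 powr a = 0, whereas the decay bound is void there.
   For a probability measure the set always contains s = 0, so the real supremum is proper. *)
definition fourier_dim_measure :: "(real ^ 'n) measure \<Rightarrow> real" where
  "fourier_dim_measure \<mu> =
     Sup {s \<in> {0..real CARD('n)}.
            \<exists>C. \<forall>\<xi>. \<xi> \<noteq> 0 \<longrightarrow> norm (fourier_transform \<mu> \<xi>) \<le> C * norm \<xi> powr (- s / 2)}"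

definition measure_support :: "'a::topological_space measure \<Rightarrow> 'a set" where
  "measure_support \<mu> = {x. \<forall>U. open U \<and> x \<in> U \<longrightarrow> emeasure \<mu> U > 0}"

definition compact_prob_measures :: "'a::topological_space set \<Rightarrow> 'a measure set" where
  "compact_prob_measures E =
     {\<mu>. prob_space \<mu> \<and> sets \<mu> = sets borel \<and>
         compact (measure_support \<mu>) \<and> measure_support \<mu> \<subseteq> E}"

(* Taking the supremum in ennreal gives the usual convention that the empty set has dimension 0. *)
definition fourier_dim :: "(real ^ 'n) set \<Rightarrow> ennreal" where
  "fourier_dim E = (SUP \<mu> \<in> compact_prob_measures E. ennreal (fourier_dim_measure \<mu>))"

definition int_lattice :: "(real ^ 'n) set" where
  "int_lattice = {z. \<forall>i. z $ i \<in> \<int>}"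

definition nearest_int_dist :: "real ^ 'n \<Rightarrow> real" where
  "nearest_int_dist x = infdist x int_lattice"

definition Bad :: "(real ^ 'n) set" where
  "Bad = {x. \<exists>c>0. \<forall>q::nat. q \<ge> 1 \<longrightarrow>
            nearest_int_dist (real q *\<^sub>R x) \<ge> c * real q powr (- 1 / real CARD('n))}"

end

theory Submission
  imports Defs
begin

text \<open>
  Suppose \<open>\<mu>\<close> is supported on a compact subset of \<open>Bad\<close> and \<open>\<bar>\<mu>^(\<xi>)\<bar> \<le> C \<bar>\<xi>\<bar>^(-a)\<close> with
  \<open>n / (n + 1) < a < n\<close>. By Baire, a nonempty relatively open part \<open>U\<close> of the support consists of
  points whose badly-approximable constant is at least a single \<open>c > 0\<close>.

  Take \<open>q = m^n\<close> and a trigonometric polynomial \<open>S\<close> on the torus with unit \<open>L2\<close> norm and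
  frequencies in a box whose side is comparable to \<open>m\<close>. In the Fourier transform of
  \<open>\<bar>S(q x)\<bar>^2 \<mu>\<close> the off-diagonal terms contribute \<open>O(q^(-a) m^(n - a)) = O(m^(n - a (n + 1)))\<close>,
  which tends to 0; so \<open>\<bar>S(q x)\<bar>^2 \<mu>\<close> converges weakly to \<open>\<mu>\<close>.

  If \<open>S\<close> has tent-shaped coefficients of width \<open>M = A m\<close> in every coordinate, then multiplication by
  \<open>1 - e(q x_i)\<close> replaces the \<open>i\<close>-th tent by its differences: it gives \<open>\<eta> S_i(q x)\<close> with \<open>S_i\<close> of
  unit norm and \<open>\<eta>^2 = O(1 / M^2)\<close>. On \<open>U\<close> the sum over \<open>i\<close> of \<open>\<bar>1 - e(q x_i)\<bar>^2\<close> is at least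
  \<open>16 (c / m)^2\<close>, so \<open>(A c)^2 \<bar>S(q x)\<bar>^2\<close> is at most half the sum of the \<open>\<bar>S_i(q x)\<bar>^2\<close>. Integrating
  a bump function \<open>f\<close> on \<open>U\<close> and letting \<open>m\<close> grow yields \<open>(A c)^2 \<integral>f \<le> n / 2 \<integral>f\<close> for every \<open>A\<close>,
  a contradiction.
\<close>

definition char_fun :: "'a::real_inner \<Rightarrow> 'a \<Rightarrow> complex" where
  "char_fun \<xi> x = cis (2 * pi * (\<xi> \<bullet> x))"

lemma norm_char_fun [simp]: "norm (char_fun \<xi> x) = 1"
  by (simp add: char_fun_def)

lemma char_fun_0 [simp]: "char_fun 0 x = 1"
  by (simp add: char_fun_def)

lemma cnj_char_fun: "cnj (char_fun \<xi> x) = char_fun (- \<xi>) x"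
  by (simp add: char_fun_def cis_cnj)

lemma char_fun_mult: "char_fun \<xi> x * char_fun \<zeta> x = char_fun (\<xi> + \<zeta>) x"
  by (simp add: char_fun_def cis_mult inner_add_left algebra_simps)

lemma char_fun_scaleR: "char_fun \<xi> (c *\<^sub>R x) = char_fun (c *\<^sub>R \<xi>) x"
  by (simp add: char_fun_def)

lemma continuous_on_char_fun [continuous_intros]:
  "continuous_on A f \<Longrightarrow> continuous_on A (\<lambda>x. char_fun \<xi> (f x))"
  unfolding char_fun_def by (intro continuous_intros)

lemma fourier_transform_eq_integral_char_fun:
  "fourier_transform \<mu> \<xi> = (\<integral>x. char_fun (- \<xi>) x \<partial>\<mu>)"
  by (simp add: fourier_transform_def char_fun_def cis_conv_exp inner_commute mult_ac)

subsection \<open>Finite Borel measures\<close>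

locale borel_finite_measure = finite_measure \<mu> for \<mu> :: "'a::topological_space measure" +
  assumes sets_eq_borel: "sets \<mu> = sets borel"
begin

lemma borel_measurable_continuous:
  "continuous_on UNIV f \<Longrightarrow> f \<in> borel_measurable \<mu>"
  using borel_measurable_continuous_onI[of f] sets_eq_borel by (simp cong: measurable_cong_sets)

lemma integrable_bounded_continuous:
  fixes f :: "'a \<Rightarrow> 'b::{second_countable_topology, banach}"
  assumes "continuous_on UNIV f" "\<And>x. norm (f x) \<le> B"
  shows "integrable \<mu> f"
  using assms by (intro integrable_const_bound[where B=B] borel_measurable_continuous) auto

end

lemma integrable_char_fun:
  "borel_finite_measure \<mu> \<Longrightarrow> integrable \<mu> (char_fun \<xi>)"
  by (rule borel_finite_measure.integrable_bounded_continuous[where B=1]) (auto intro: continuous_intros)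

locale borel_finite_measure_on = borel_finite_measure +
  fixes K
  assumes compact_carrier: "compact K" and AE_carrier: "AE x in \<mu>. x \<in> K"
begin

lemma integrable_continuous:
  fixes f :: "'a \<Rightarrow> 'b::{second_countable_topology, banach}"
  assumes "continuous_on UNIV f"
  shows "integrable \<mu> f"
proof -
  have "bounded (f ` K)"
    using assms compact_carrier
    by (intro compact_imp_bounded compact_continuous_image) (auto intro: continuous_on_subset)
  then obtain B where "\<And>x. x \<in> K \<Longrightarrow> norm (f x) \<le> B"
    by (auto simp: bounded_iff)
  then have "AE x in \<mu>. norm (f x) \<le> B"
    using AE_carrier by (auto elim: eventually_mono)
  then show ?thesis
    using assms by (intro integrable_const_bound borel_measurable_continuous)
qed

lemma abs_integral_diff_le:
  fixes f g :: "'a \<Rightarrow> real"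
  assumes "continuous_on UNIV f" "continuous_on UNIV g" and "\<And>x. x \<in> K \<Longrightarrow> \<bar>f x - g x\<bar> \<le> e"
  shows "\<bar>(\<integral>x. f x \<partial>\<mu>) - (\<integral>x. g x \<partial>\<mu>)\<bar> \<le> e * measure \<mu> (space \<mu>)"
proof -
  have "\<bar>\<integral>x. f x - g x \<partial>\<mu>\<bar> \<le> (\<integral>x. \<bar>f x - g x\<bar> \<partial>\<mu>)"
    by (rule integral_abs_bound)
  also have "\<dots> \<le> (\<integral>x. e \<partial>\<mu>)"
    using assms AE_carrier
    by (intro integral_mono_AE integrable_continuous continuous_intros) (auto elim: eventually_mono)
  finally show ?thesis
    using assms by (simp add: integrable_continuous mult.commute)
qed

lemma borel_finite_measure_on_density:
  fixes h :: "'a \<Rightarrow> real"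
  assumes "continuous_on UNIV h" "\<And>x. 0 \<le> h x"
  shows "borel_finite_measure_on (density \<mu> h) K"
proof -
  have h: "h \<in> borel_measurable \<mu>" "integrable \<mu> h"
    using assms by (auto intro: borel_measurable_continuous integrable_continuous)
  have "emeasure (density \<mu> h) (space \<mu>) = ennreal (\<integral>x. h x \<partial>\<mu>)"
    using h assms(2) by (simp add: emeasure_density nn_integral_eq_integral cong: nn_integral_cong)
  then have "finite_measure (density \<mu> h)"
    by (intro finite_measureI) simp
  moreover have "AE x in density \<mu> h. x \<in> K"
    using h AE_carrier by (auto simp: AE_density elim: eventually_mono)
  ultimately show ?thesis
    by (intro borel_finite_measure_on.intro borel_finite_measure.intro borel_finite_measure_axioms.intro
        borel_finite_measure_on_axioms.intro compact_carrier) (simp_all add: sets_eq_borel)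
qed

lemma integral_density_continuous:
  fixes h :: "'a \<Rightarrow> real" and f :: "'a \<Rightarrow> 'b::{second_countable_topology, banach}"
  assumes "continuous_on UNIV h" "\<And>x. 0 \<le> h x" "continuous_on UNIV f"
  shows "(\<integral>x. f x \<partial>density \<mu> h) = (\<integral>x. h x *\<^sub>R f x \<partial>\<mu>)"
  using assms by (intro integral_density borel_measurable_continuous) auto

end

subsection \<open>Trigonometric polynomials and weak convergence\<close>

inductive_set trig_poly :: "('a::real_inner \<Rightarrow> real) set" where
  Re_char_fun: "(\<lambda>x. Re (c * char_fun \<xi> x)) \<in> trig_poly"
| add: "f \<in> trig_poly \<Longrightarrow> g \<in> trig_poly \<Longrightarrow> (\<lambda>x. f x + g x) \<in> trig_poly"

lemma trig_poly_const: "(\<lambda>x. c) \<in> trig_poly"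
  using trig_poly.Re_char_fun[of "of_real c" 0] by simp

lemma continuous_on_trig_poly: "f \<in> trig_poly \<Longrightarrow> continuous_on A f"
  by (induction rule: trig_poly.induct) (auto intro!: continuous_intros)

lemma trig_poly_Re_char_fun_mult:
  assumes "g \<in> trig_poly"
  shows "(\<lambda>x. Re (c * char_fun \<xi> x) * g x) \<in> trig_poly"
  using assms
proof induction
  case (Re_char_fun d \<zeta>)
  have "Re (c * char_fun \<xi> x) * Re (d * char_fun \<zeta> x) =
      Re (c * d / 2 * char_fun (\<xi> + \<zeta>) x) + Re (c * cnj d / 2 * char_fun (\<xi> - \<zeta>) x)" for x
  proof -
    have "Re z * Re w = Re (z * w / 2) + Re (z * cnj w / 2)" for z w
      by (simp add: field_simps)
    moreover have "c * char_fun \<xi> x * (d * char_fun \<zeta> x) = c * d * char_fun (\<xi> + \<zeta>) x"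
      by (simp flip: char_fun_mult)
    moreover have "c * char_fun \<xi> x * cnj (d * char_fun \<zeta> x) = c * cnj d * char_fun (\<xi> - \<zeta>) x"
      by (simp add: cnj_char_fun diff_conv_add_uminus del: add_uminus_conv_diff flip: char_fun_mult)
    ultimately show ?thesis
      by (simp only: times_divide_eq_left)
  qed
  then show ?case
    by (simp only: trig_poly.intros)
next
  case (add f g)
  then show ?case
    using trig_poly.add[OF add.IH] by (simp add: distrib_left)
qed

lemma trig_poly_mult:
  assumes "f \<in> trig_poly" "g \<in> trig_poly"
  shows "(\<lambda>x. f x * g x) \<in> trig_poly"
  using assms(1)
proof induction
  case (Re_char_fun c \<xi>)
  show ?case
    using assms(2) by (rule trig_poly_Re_char_fun_mult)
next
  case (add f h)
  then show ?case
    using trig_poly.add[OF add.IH] by (simp add: distrib_right)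
qed

lemma trig_poly_separates_points:
  assumes "x \<noteq> y"
  shows "\<exists>f\<in>trig_poly. f x \<noteq> f y"
proof -
  define \<xi> where "\<xi> = (1 / (4 * ((x - y) \<bullet> (x - y)))) *\<^sub>R (x - y)"
  define f where "f z = Re (char_fun (- \<xi>) y * char_fun \<xi> z)" for z
  have f: "f z = cos (2 * pi * (\<xi> \<bullet> (z - y)))" for z
    by (simp add: f_def char_fun_def cis_mult inner_diff_right algebra_simps)
  have "\<xi> \<bullet> (x - y) = 1 / 4"
    using assms by (simp add: \<xi>_def)
  then have "2 * pi * (\<xi> \<bullet> (x - y)) = pi / 2"
    by simp
  then have "f x = 0"
    by (simp only: f cos_pi_half)
  moreover have "f y = 1"
    by (simp add: f)
  moreover have "f \<in> trig_poly"
    unfolding f_def by (rule trig_poly.Re_char_fun)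
  ultimately show ?thesis
    by (intro bexI[of _ f]) simp
qed

lemma trig_poly_dense:
  fixes f :: "'a::real_inner \<Rightarrow> real"
  assumes "compact K" "continuous_on K f" "e > 0"
  obtains g where "g \<in> trig_poly" "\<And>x. x \<in> K \<Longrightarrow> \<bar>f x - g x\<bar> < e"
proof -
  interpret function_ring_on trig_poly K
    by unfold_locales
       (use assms(1) trig_poly_separates_points in
         \<open>auto intro: continuous_on_trig_poly trig_poly.add trig_poly_mult trig_poly_const\<close>)
  show ?thesis
    using Stone_Weierstrass_basic[OF assms(2,3)] that by blast
qed

lemma integrable_trig_poly:
  assumes "borel_finite_measure \<mu>" "g \<in> trig_poly"
  shows "integrable \<mu> g"
  using assms(2)
  by induction (intro integrable_Re integrable_mult_right integrable_char_fun assms(1), simp)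

lemma tendsto_integral_trig_poly:
  fixes \<mu> :: "(real ^ 'n) measure" and \<nu> :: "nat \<Rightarrow> (real ^ 'n) measure"
  assumes \<mu>: "borel_finite_measure \<mu>" and \<nu>: "\<And>m. borel_finite_measure (\<nu> m)"
    and lim: "\<And>\<xi>. (\<lambda>m. fourier_transform (\<nu> m) \<xi>) \<longlonglongrightarrow> fourier_transform \<mu> \<xi>"
    and "g \<in> trig_poly"
  shows "(\<lambda>m. \<integral>x. g x \<partial>\<nu> m) \<longlonglongrightarrow> (\<integral>x. g x \<partial>\<mu>)"
  using \<open>g \<in> trig_poly\<close>
proof induction
  case (Re_char_fun c \<xi>)
  have "(\<integral>x. Re (c * char_fun \<xi> x) \<partial>M) = Re (c * fourier_transform M (- \<xi>))"
    if "borel_finite_measure M" for M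
  proof -
    have "integrable M (\<lambda>x. c * char_fun \<xi> x)"
      using that by (intro integrable_mult_right integrable_char_fun)
    then show ?thesis
      by (simp only: integral_Re integral_mult_right_zero fourier_transform_eq_integral_char_fun minus_minus)
  qed
  moreover have "(\<lambda>m. Re (c * fourier_transform (\<nu> m) (- \<xi>))) \<longlonglongrightarrow> Re (c * fourier_transform \<mu> (- \<xi>))"
    by (intro tendsto_intros lim)
  ultimately show ?case
    using \<mu> \<nu> by (simp only:)
next
  case (add f g)
  from tendsto_add[OF add.IH] show ?case
    using add.hyps \<mu> \<nu> by (simp add: integrable_trig_poly)
qed

lemma tendsto_integral_if_fourier_transform_tendsto:
  fixes \<mu> :: "(real ^ 'n) measure" and \<nu> :: "nat \<Rightarrow> (real ^ 'n) measure"
  assumes \<mu>: "borel_finite_measure_on \<mu> K" and \<nu>: "\<And>m. borel_finite_measure_on (\<nu> m) K"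
    and lim: "\<And>\<xi>. (\<lambda>m. fourier_transform (\<nu> m) \<xi>) \<longlonglongrightarrow> fourier_transform \<mu> \<xi>"
    and f: "continuous_on UNIV f"
  shows "(\<lambda>m. \<integral>x. f x \<partial>\<nu> m) \<longlonglongrightarrow> (\<integral>x. f x \<partial>\<mu> :: real)"
proof (rule tendstoI)
  interpret \<mu>: borel_finite_measure_on \<mu> K by fact
  interpret \<nu>: borel_finite_measure_on "\<nu> m" K for m by fact
  have trig: "(\<lambda>m. \<integral>x. g x \<partial>\<nu> m) \<longlonglongrightarrow> (\<integral>x. g x \<partial>\<mu>)" if "g \<in> trig_poly" for g
    by (rule tendsto_integral_trig_poly[OF \<mu>.borel_finite_measure_axioms \<nu>.borel_finite_measure_axioms lim that])
  have mass: "(\<lambda>m. measure (\<nu> m) (space (\<nu> m))) \<longlonglongrightarrow> measure \<mu> (space \<mu>)"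
    using trig[OF trig_poly_const[of 1]] by simp
  fix \<epsilon> :: real assume "\<epsilon> > 0"
  define \<delta> where "\<delta> = \<epsilon> / (2 * measure \<mu> (space \<mu>) + 1)"
  have \<delta>: "\<delta> > 0" "2 * \<delta> * measure \<mu> (space \<mu>) < \<epsilon>"
    using \<open>\<epsilon> > 0\<close> by (simp_all add: \<delta>_def field_simps add_pos_nonneg add_nonneg_pos)
  obtain g where g: "g \<in> trig_poly" "\<And>x. x \<in> K \<Longrightarrow> \<bar>f x - g x\<bar> < \<delta>"
    using trig_poly_dense[OF \<mu>.compact_carrier continuous_on_subset[OF f subset_UNIV] \<delta>(1)]
    by blast
  define err where "err m = \<delta> * measure (\<nu> m) (space (\<nu> m)) + \<delta> * measure \<mu> (space \<mu>)
    + \<bar>(\<integral>x. g x \<partial>\<nu> m) - (\<integral>x. g x \<partial>\<mu>)\<bar>" for m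
  have "err \<longlonglongrightarrow> \<delta> * measure \<mu> (space \<mu>) + \<delta> * measure \<mu> (space \<mu>)
      + \<bar>(\<integral>x. g x \<partial>\<mu>) - (\<integral>x. g x \<partial>\<mu>)\<bar>"
    unfolding err_def by (intro tendsto_intros mass trig g(1))
  then have "eventually (\<lambda>m. err m < \<epsilon>) sequentially"
    by (rule order_tendstoD) (use \<delta>(2) in simp)
  then show "eventually (\<lambda>m. dist (\<integral>x. f x \<partial>\<nu> m) (\<integral>x. f x \<partial>\<mu>) < \<epsilon>) sequentially"
  proof eventually_elim
    case (elim m)
    have "\<bar>(\<integral>x. f x \<partial>\<nu> m) - (\<integral>x. g x \<partial>\<nu> m)\<bar> \<le> \<delta> * measure (\<nu> m) (space (\<nu> m))"
      using g by (intro \<nu>.abs_integral_diff_le f continuous_on_trig_poly) (auto intro: less_imp_le)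
    moreover have "\<bar>(\<integral>x. f x \<partial>\<mu>) - (\<integral>x. g x \<partial>\<mu>)\<bar> \<le> \<delta> * measure \<mu> (space \<mu>)"
      using g by (intro \<mu>.abs_integral_diff_le f continuous_on_trig_poly) (auto intro: less_imp_le)
    ultimately show ?case
      using elim unfolding err_def dist_real_def by linarith
  qed
qed

subsection \<open>Fourier decay and Fourier dimension\<close>

definition fourier_decay :: "real \<Rightarrow> real \<Rightarrow> (real ^ 'n) measure \<Rightarrow> bool" where
  "fourier_decay C a \<mu> \<longleftrightarrow> (\<forall>\<xi>. \<xi> \<noteq> 0 \<longrightarrow> norm (fourier_transform \<mu> \<xi>) \<le> C * norm \<xi> powr (- a))"

lemma fourier_decay_imp_nonneg:
  fixes \<mu> :: "(real ^ 'n) measure"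
  assumes "fourier_decay C a \<mu>"
  shows "0 \<le> C"
proof -
  have "norm (fourier_transform \<mu> (vec 1)) \<le> C * norm (vec 1 :: real ^ 'n) powr (- a)"
    using assms by (simp add: fourier_decay_def vec_eq_iff)
  then have "0 \<le> C * norm (vec 1 :: real ^ 'n) powr (- a)"
    by (rule order_trans[OF norm_ge_zero])
  then show ?thesis
    by (simp add: zero_le_mult_iff vec_eq_iff)
qed

lemma fourier_dim_measure_eq_Sup_decay:
  fixes \<mu> :: "(real ^ 'n) measure"
  shows "fourier_dim_measure \<mu> = Sup {s \<in> {0..real CARD('n)}. \<exists>C. fourier_decay C (s / 2) \<mu>}"
  by (simp add: fourier_dim_measure_def fourier_decay_def)

lemma fourier_decay_zero:
  assumes "prob_space \<mu>"
  shows "fourier_decay 1 0 \<mu>"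
proof -
  interpret prob_space \<mu> by fact
  have "norm (fourier_transform \<mu> \<xi>) \<le> 1" for \<xi>
    unfolding fourier_transform_eq_integral_char_fun
    by (rule order_trans[OF integral_norm_bound]) (simp add: prob_space)
  then show ?thesis
    by (simp add: fourier_decay_def)
qed

lemma fourier_dim_measure_le:
  fixes \<mu> :: "(real ^ 'n) measure"
  assumes "prob_space \<mu>"
    and "\<And>C s. s \<le> real CARD('n) \<Longrightarrow> fourier_decay C (s / 2) \<mu> \<Longrightarrow> s \<le> b"
  shows "fourier_dim_measure \<mu> \<le> b"
  unfolding fourier_dim_measure_eq_Sup_decay
proof (rule cSup_least)
  have "0 \<in> {s \<in> {0..real CARD('n)}. \<exists>C. fourier_decay C (s / 2) \<mu>}"
    using fourier_decay_zero[OF assms(1)] by auto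
  then show "{s \<in> {0..real CARD('n)}. \<exists>C. fourier_decay C (s / 2) \<mu>} \<noteq> {}"
    by blast
qed (use assms(2) in auto)

subsection \<open>Elementary sum estimates\<close>

lemma sum_powr_minus_le:
  assumes "0 \<le> b" "b < 1"
  shows "(\<Sum>j<L. (1 + real j) powr (- b)) \<le> real L powr (1 - b) / (1 - b)"
proof (induction L)
  case (Suc L)
  have "(1 + real L) powr (- b) \<le> (1 + real L) powr (1 - b) / (1 - b) - real L powr (1 - b) / (1 - b)"
  proof (cases "L = 0")
    case True
    then show ?thesis
      using assms by simp
  next
    case False
    have "real L powr (1 - b) * (1 + real L) powr b \<le> (1 - b) * real L + b * (1 + real L)"
      using assms False by (intro Youngs_inequality_0) auto
    then have "(real L powr (1 - b) * (1 + real L) powr b) * (1 + real L) powr (- b)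
        \<le> ((1 + real L) - (1 - b)) * (1 + real L) powr (- b)"
      by (intro mult_right_mono) (auto simp: algebra_simps)
    also have "(real L powr (1 - b) * (1 + real L) powr b) * (1 + real L) powr (- b) = real L powr (1 - b)"
      by (simp add: mult.assoc flip: powr_add)
    also have "((1 + real L) - (1 - b)) * (1 + real L) powr (- b)
        = (1 + real L) powr (1 - b) - (1 - b) * (1 + real L) powr (- b)"
      using powr_mult_base[of "1 + real L" "- b"] by (simp add: algebra_simps)
    finally show ?thesis
      using assms by (simp add: pos_le_divide_eq algebra_simps flip: diff_divide_distrib)
  qed
  with Suc show ?case
    by (simp add: add.commute)
qed simp

lemma sum_abs_diff_nat_le:
  fixes w :: "real \<Rightarrow> real"
  assumes "\<And>t. 0 \<le> w t" "k < L"
  shows "(\<Sum>l<L. w \<bar>real k - real l\<bar>) \<le> 2 * (\<Sum>j<L. w (real j))"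
proof -
  have "(\<Sum>l<L. w \<bar>real k - real l\<bar>)
      = (\<Sum>l\<le>k. w \<bar>real k - real l\<bar>) + (\<Sum>l\<in>{k<..<L}. w \<bar>real k - real l\<bar>)"
    using assms(2) by (subst sum.union_disjoint[symmetric]) (auto intro: sum.cong)
  also have "(\<Sum>l\<le>k. w \<bar>real k - real l\<bar>) = (\<Sum>j\<le>k. w (real j))"
    by (rule sum.reindex_bij_witness[of _ "\<lambda>j. k - j" "\<lambda>l. k - l"]) (auto simp: of_nat_diff)
  also have "\<dots> \<le> (\<Sum>j<L. w (real j))"
    using assms by (intro sum_mono2) auto
  also have "(\<Sum>l\<in>{k<..<L}. w \<bar>real k - real l\<bar>) = (\<Sum>j\<in>{1..<L - k}. w (real j))"
    by (rule sum.reindex_bij_witness[of _ "\<lambda>j. k + j" "\<lambda>l. l - k"]) (auto simp: of_nat_diff)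
  also have "\<dots> \<le> (\<Sum>j<L. w (real j))"
    using assms by (intro sum_mono2) auto
  finally show ?thesis
    by simp
qed

lemma schur_test:
  fixes s :: "'i \<Rightarrow> real" and \<rho> :: "'i \<Rightarrow> 'i \<Rightarrow> real"
  assumes nonneg: "\<And>k l. 0 \<le> \<rho> k l" and sym: "\<And>k l. \<rho> k l = \<rho> l k"
    and row_sum: "\<And>k. k \<in> I \<Longrightarrow> (\<Sum>l\<in>I. \<rho> k l) \<le> R"
  shows "(\<Sum>k\<in>I. \<Sum>l\<in>I. \<bar>s k * s l\<bar> * \<rho> k l) \<le> R * (\<Sum>k\<in>I. (s k)\<^sup>2)"
proof -
  have "(\<Sum>k\<in>I. \<Sum>l\<in>I. \<bar>s k * s l\<bar> * \<rho> k l) \<le> (\<Sum>k\<in>I. \<Sum>l\<in>I. ((s k)\<^sup>2 / 2 + (s l)\<^sup>2 / 2) * \<rho> k l)"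
    using sum_squares_bound[of "\<bar>s k\<bar>" "\<bar>s l\<bar>" for k l] nonneg
    by (intro sum_mono mult_right_mono) (auto simp: abs_mult field_simps)
  also have "\<dots> = (\<Sum>k\<in>I. \<Sum>l\<in>I. (s k)\<^sup>2 / 2 * \<rho> k l) + (\<Sum>k\<in>I. \<Sum>l\<in>I. (s l)\<^sup>2 / 2 * \<rho> k l)"
    by (simp add: distrib_right sum.distrib)
  also have "(\<Sum>k\<in>I. \<Sum>l\<in>I. (s l)\<^sup>2 / 2 * \<rho> k l) = (\<Sum>k\<in>I. \<Sum>l\<in>I. (s k)\<^sup>2 / 2 * \<rho> k l)"
    by (subst sum.swap) (simp add: sym)
  also have "(\<Sum>k\<in>I. \<Sum>l\<in>I. (s k)\<^sup>2 / 2 * \<rho> k l) + (\<Sum>k\<in>I. \<Sum>l\<in>I. (s k)\<^sup>2 / 2 * \<rho> k l)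
      = (\<Sum>k\<in>I. (s k)\<^sup>2 * (\<Sum>l\<in>I. \<rho> k l))"
    by (simp add: sum_distrib_left flip: sum.distrib) (simp only: mult.commute)
  also have "\<dots> \<le> (\<Sum>k\<in>I. (s k)\<^sup>2 * R)"
    by (intro sum_mono mult_left_mono row_sum) auto
  finally show ?thesis
    by (simp only: mult.commute[of R] sum_distrib_right)
qed

subsection \<open>Equidistribution of dilated trigonometric densities\<close>

definition nat_vec :: "('n::finite \<Rightarrow> nat) \<Rightarrow> real ^ 'n" where
  "nat_vec k = (\<chi> i. real (k i))"

definition index_box :: "nat \<Rightarrow> ('n::finite \<Rightarrow> nat) set" where
  "index_box L = UNIV \<rightarrow>\<^sub>E {..<L}"

definition trig_sum :: "(('n::finite \<Rightarrow> nat) \<Rightarrow> real) \<Rightarrow> nat \<Rightarrow> real ^ 'n \<Rightarrow> complex" where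
  "trig_sum s L x = (\<Sum>k\<in>index_box L. of_real (s k) * char_fun (nat_vec k) x)"

definition energy :: "(('n::finite \<Rightarrow> nat) \<Rightarrow> real) \<Rightarrow> nat \<Rightarrow> real" where
  "energy s L = (\<Sum>k\<in>index_box L. (s k)\<^sup>2)"

text \<open>By Parseval this is a probability density on the torus; it is identically 0 for zero coefficients.\<close>

definition trig_density :: "(('n::finite \<Rightarrow> nat) \<Rightarrow> real) \<Rightarrow> nat \<Rightarrow> real ^ 'n \<Rightarrow> real" where
  "trig_density s L x = (norm (trig_sum s L x))\<^sup>2 / energy s L"

lemma finite_index_box [simp]: "finite (index_box L)"
  by (simp add: index_box_def finite_PiE)

lemma sum_index_box_prod:
  fixes f :: "'n::finite \<Rightarrow> nat \<Rightarrow> 'c::comm_semiring_1"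
  shows "(\<Sum>k\<in>index_box L. \<Prod>i\<in>UNIV. f i (k i)) = (\<Prod>i\<in>UNIV. \<Sum>j<L. f i j)"
  by (simp add: index_box_def prod_sum_PiE)

lemma energy_nonneg: "0 \<le> energy s L"
  by (simp add: energy_def sum_nonneg)

lemma trig_density_nonneg: "0 \<le> trig_density s L x"
  by (simp add: trig_density_def energy_nonneg)

lemma continuous_on_trig_density [continuous_intros]:
  "continuous_on A f \<Longrightarrow> continuous_on A (\<lambda>x. trig_density s L (f x))"
  unfolding trig_density_def trig_sum_def divide_inverse by (intro continuous_intros)

lemma norm_trig_sum_sq:
  "of_real ((norm (trig_sum s L x))\<^sup>2) =
     (\<Sum>k\<in>index_box L. \<Sum>l\<in>index_box L. of_real (s k * s l) * char_fun (nat_vec k - nat_vec l) x)"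
proof -
  have "of_real ((norm (trig_sum s L x))\<^sup>2) =
      (\<Sum>k\<in>index_box L. \<Sum>l\<in>index_box L.
         of_real (s k) * char_fun (nat_vec k) x * (of_real (s l) * char_fun (- nat_vec l) x))"
    unfolding complex_norm_square trig_sum_def by (simp add: cnj_char_fun sum_product)
  also have "\<dots> = (\<Sum>k\<in>index_box L. \<Sum>l\<in>index_box L. of_real (s k * s l) * char_fun (nat_vec k - nat_vec l) x)"
    by (intro sum.cong refl)
       (simp add: mult_ac diff_conv_add_uminus del: add_uminus_conv_diff flip: char_fun_mult)
  finally show ?thesis .
qed

lemma fourier_transform_density_trig_density:
  assumes "borel_finite_measure \<mu>"
  shows "fourier_transform (density \<mu> (\<lambda>x. trig_density s L (q *\<^sub>R x))) \<xi> =
    (\<Sum>k\<in>index_box L. \<Sum>l\<in>index_box L.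
       of_real (s k * s l) * fourier_transform \<mu> (\<xi> - q *\<^sub>R (nat_vec k - nat_vec l))) / energy s L"
proof -
  interpret borel_finite_measure \<mu> by fact
  define v where "v k l = nat_vec k - nat_vec l" for k l :: "'a \<Rightarrow> nat"
  have expand: "trig_density s L (q *\<^sub>R x) *\<^sub>R char_fun (- \<xi>) x =
      (\<Sum>k\<in>index_box L. \<Sum>l\<in>index_box L. of_real (s k * s l) * char_fun (- (\<xi> - q *\<^sub>R v k l)) x) / energy s L" for x
  proof -
    have "char_fun (- (\<xi> - q *\<^sub>R v k l)) x = char_fun (v k l) (q *\<^sub>R x) * char_fun (- \<xi>) x" for k l
      by (simp add: char_fun_scaleR char_fun_mult)
    then show ?thesis
      unfolding trig_density_def scaleR_conv_of_real of_real_divide norm_trig_sum_sq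
      by (simp add: v_def sum_distrib_right mult.assoc)
  qed
  have "fourier_transform (density \<mu> (\<lambda>x. trig_density s L (q *\<^sub>R x))) \<xi> =
      (\<integral>x. trig_density s L (q *\<^sub>R x) *\<^sub>R char_fun (- \<xi>) x \<partial>\<mu>)"
    unfolding fourier_transform_eq_integral_char_fun
    by (intro integral_density borel_measurable_continuous continuous_intros)
       (simp add: trig_density_nonneg)
  also have "\<dots> = (\<Sum>k\<in>index_box L. \<Sum>l\<in>index_box L. of_real (s k * s l) * fourier_transform \<mu> (\<xi> - q *\<^sub>R v k l)) / energy s L"
    unfolding expand fourier_transform_eq_integral_char_fun using assms
    by (simp add: integrable_char_fun del: minus_diff_eq)
  finally show ?thesis
    by (simp only: v_def)
qed

lemma norm_nat_vec_diff_ge_component: "\<bar>real (k i) - real (l i)\<bar> \<le> norm (nat_vec k - nat_vec l)"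
  using component_le_norm_cart[of "nat_vec k - nat_vec l" i] by (simp add: nat_vec_def)

lemma norm_nat_vec_diff_ge_1:
  assumes "k \<noteq> l"
  shows "1 \<le> norm (nat_vec k - nat_vec l)"
proof -
  obtain j where "k j \<noteq> l j"
    using assms by auto
  then have "1 \<le> \<bar>real (k j) - real (l j)\<bar>"
    by linarith
  also have "\<dots> \<le> norm (nat_vec k - nat_vec l)"
    by (rule norm_nat_vec_diff_ge_component)
  finally show ?thesis .
qed

lemma norm_nat_vec_diff_powr_le:
  fixes k l :: "'n::finite \<Rightarrow> nat"
  assumes "k \<noteq> l" "0 \<le> a"
  shows "norm (nat_vec k - nat_vec l) powr (- a) \<le>
    2 powr a * (\<Prod>i\<in>UNIV. (1 + \<bar>real (k i) - real (l i)\<bar>) powr (- (a / real CARD('n))))"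
proof -
  define b where "b = a / real CARD('n)"
  have b: "0 \<le> b" "a = b * real CARD('n)"
    using assms(2) by (simp_all add: b_def)
  have powr_eq_prod: "t powr c = (\<Prod>i\<in>(UNIV :: 'n set). t powr (c / real CARD('n)))" if "t > 0" for t c :: real
    using that by (simp add: powr_power)
  have component: "(1 + \<bar>real (k i) - real (l i)\<bar>) / 2 \<le> norm (nat_vec k - nat_vec l)" for i
    using norm_nat_vec_diff_ge_1[OF assms(1)] norm_nat_vec_diff_ge_component[of k i l] by simp
  have "0 < norm (nat_vec k - nat_vec l)"
    using norm_nat_vec_diff_ge_1[OF assms(1)] by linarith
  \<comment> \<open>Splitting the decay evenly over the coordinates makes the sum over the box factorise.\<close>
  then have "norm (nat_vec k - nat_vec l) powr (- a) = (\<Prod>i\<in>(UNIV :: 'n set). norm (nat_vec k - nat_vec l) powr (- b))"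
    by (simp add: powr_eq_prod[of _ "- a"] b_def)
  also have "\<dots> \<le> (\<Prod>i\<in>UNIV. ((1 + \<bar>real (k i) - real (l i)\<bar>) / 2) powr (- b))"
    using b component by (intro prod_mono conjI powr_mono2') (auto simp: add_pos_nonneg)
  also have "\<dots> = (\<Prod>i\<in>UNIV. 2 powr b * (1 + \<bar>real (k i) - real (l i)\<bar>) powr (- b))"
    by (simp add: powr_divide powr_minus field_simps)
  also have "\<dots> = 2 powr a * (\<Prod>i\<in>UNIV. (1 + \<bar>real (k i) - real (l i)\<bar>) powr (- b))"
    by (simp add: prod.distrib powr_eq_prod[of 2 a] b_def)
  finally show ?thesis
    by (simp only: b_def)
qed

lemma sum_index_box_powr_le:
  fixes k :: "'n::finite \<Rightarrow> nat"
  assumes "k \<in> index_box L" "0 \<le> b" "b < 1"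
  shows "(\<Sum>l\<in>index_box L. \<Prod>i\<in>UNIV. (1 + \<bar>real (k i) - real (l i)\<bar>) powr (- b))
    \<le> (2 / (1 - b) * real L powr (1 - b)) ^ CARD('n)"
proof -
  have "(\<Sum>l<L. (1 + \<bar>real (k i) - real l\<bar>) powr (- b)) \<le> 2 / (1 - b) * real L powr (1 - b)" for i
  proof -
    have "k i < L"
      using assms(1) by (auto simp: index_box_def)
    then have "(\<Sum>l<L. (1 + \<bar>real (k i) - real l\<bar>) powr (- b)) \<le> 2 * (\<Sum>j<L. (1 + real j) powr (- b))"
      by (intro sum_abs_diff_nat_le[where w="\<lambda>t. (1 + t) powr (- b)"]) auto
    with sum_powr_minus_le[OF assms(2,3), of L] show ?thesis
      by simp
  qed
  then have "(\<Prod>i\<in>UNIV. \<Sum>l<L. (1 + \<bar>real (k i) - real l\<bar>) powr (- b))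
      \<le> (\<Prod>i\<in>(UNIV :: 'n set). 2 / (1 - b) * real L powr (1 - b))"
    by (intro prod_mono conjI sum_nonneg) auto
  then show ?thesis
    by (simp add: sum_index_box_prod[where f="\<lambda>i l. (1 + \<bar>real (k i) - real l\<bar>) powr (- b)"])
qed

lemma norm_diff_scaleR_ge:
  fixes \<xi> v :: "'a::real_normed_vector"
  assumes "0 < q" "2 * norm \<xi> \<le> q" "1 \<le> norm v"
  shows "q / 2 * norm v \<le> norm (\<xi> - q *\<^sub>R v)"
proof -
  have "norm \<xi> \<le> q / 2 * norm v"
    using mult_left_mono[OF assms(3), of "q / 2"] assms(1,2) by linarith
  moreover have "q * norm v \<le> norm (\<xi> - q *\<^sub>R v) + norm \<xi>"
    using norm_triangle_ineq4[of \<xi> "\<xi> - q *\<^sub>R v"] assms(1) by simp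
  ultimately show ?thesis
    by simp
qed

lemma norm_fourier_transform_shift_le:
  fixes \<mu> :: "(real ^ 'n) measure" and k l :: "'n \<Rightarrow> nat"
  assumes decay: "fourier_decay C a \<mu>" "0 \<le> a" and q: "0 < q" "2 * norm \<xi> \<le> q" and "k \<noteq> l"
  shows "norm (fourier_transform \<mu> (\<xi> - q *\<^sub>R (nat_vec k - nat_vec l))) \<le>
    C * (4 / q) powr a * (\<Prod>i\<in>UNIV. (1 + \<bar>real (k i) - real (l i)\<bar>) powr (- (a / real CARD('n))))"
proof -
  define v where "v = nat_vec k - nat_vec l"
  define P where "P = (\<Prod>i\<in>UNIV. (1 + \<bar>real (k i) - real (l i)\<bar>) powr (- (a / real CARD('n))))"
  have norm_v: "1 \<le> norm v"
    unfolding v_def by (rule norm_nat_vec_diff_ge_1) fact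
  have shift_ge: "q / 2 * norm v \<le> norm (\<xi> - q *\<^sub>R v)"
    by (rule norm_diff_scaleR_ge[OF q norm_v])
  have shift_pos: "0 < q / 2 * norm v"
    using q norm_v by (intro mult_pos_pos) auto
  have C: "0 \<le> C"
    by (rule fourier_decay_imp_nonneg) fact
  have "norm (fourier_transform \<mu> (\<xi> - q *\<^sub>R v)) \<le> C * norm (\<xi> - q *\<^sub>R v) powr (- a)"
    using decay(1) shift_ge shift_pos by (cases "\<xi> - q *\<^sub>R v = 0") (simp_all add: fourier_decay_def)
  also have "\<dots> \<le> C * (q / 2 * norm v) powr (- a)"
    using shift_ge shift_pos C decay(2) by (intro mult_left_mono powr_mono2') auto
  also have "\<dots> = C * ((2 / q) powr a * norm v powr (- a))"
    using q norm_v by (simp add: powr_mult powr_divide powr_minus field_simps)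
  also have "\<dots> \<le> C * ((2 / q) powr a * (2 powr a * P))"
    unfolding v_def P_def using C assms(2,5)
    by (intro mult_left_mono norm_nat_vec_diff_powr_le) auto
  also have "\<dots> = C * (4 / q) powr a * P"
    using powr_mult[of "2 / q" 2 a] by (simp add: mult_ac)
  finally show ?thesis
    by (simp only: v_def P_def)
qed

lemma fourier_transform_trig_density_diff:
  assumes "borel_finite_measure \<mu>" "energy s L \<noteq> 0"
  shows "fourier_transform (density \<mu> (\<lambda>x. trig_density s L (q *\<^sub>R x))) \<xi> - fourier_transform \<mu> \<xi> =
    (\<Sum>k\<in>index_box L. \<Sum>l\<in>index_box L. of_real (s k * s l) *
       (if k = l then 0 else fourier_transform \<mu> (\<xi> - q *\<^sub>R (nat_vec k - nat_vec l)))) / energy s L"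
proof -
  define J where "J k l = fourier_transform \<mu> (\<xi> - q *\<^sub>R (nat_vec k - nat_vec l))" for k l
  have "(\<Sum>k\<in>index_box L. \<Sum>l\<in>index_box L. of_real (s k * s l) * (if k = l then fourier_transform \<mu> \<xi> else 0))
      = of_real (energy s L) * fourier_transform \<mu> \<xi>"
    by (simp add: energy_def power2_eq_square sum_distrib_right if_distrib cong: if_cong)
  then have "fourier_transform (density \<mu> (\<lambda>x. trig_density s L (q *\<^sub>R x))) \<xi> - fourier_transform \<mu> \<xi> =
      (\<Sum>k\<in>index_box L. \<Sum>l\<in>index_box L.
         of_real (s k * s l) * (J k l - (if k = l then fourier_transform \<mu> \<xi> else 0))) / energy s L"
    using assms(2) unfolding fourier_transform_density_trig_density[OF assms(1)]
    by (simp add: J_def right_diff_distrib sum_subtractf diff_divide_distrib del: of_real_mult)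
  moreover have "J k l - (if k = l then fourier_transform \<mu> \<xi> else 0) = (if k = l then 0 else J k l)" for k l
    by (simp add: J_def)
  ultimately show ?thesis
    by (simp only: J_def)
qed

lemma norm_fourier_transform_trig_density_diff_le:
  fixes \<mu> :: "(real ^ 'n) measure"
  assumes \<mu>: "borel_finite_measure \<mu>" and decay: "fourier_decay C a \<mu>" "0 \<le> a" "a < real CARD('n)"
    and q: "0 < q" "2 * norm \<xi> \<le> q" and energy: "energy s L \<noteq> 0"
  shows "norm (fourier_transform (density \<mu> (\<lambda>x. trig_density s L (q *\<^sub>R x))) \<xi> - fourier_transform \<mu> \<xi>)
    \<le> C * (4 / q) powr a * (2 / (1 - a / real CARD('n))) ^ CARD('n) * real L powr (real CARD('n) - a)"
proof -
  define b where "b = a / real CARD('n)"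
  have b: "0 \<le> b" "b < 1" "real CARD('n) * (1 - b) = real CARD('n) - a"
    using decay by (simp_all add: b_def right_diff_distrib)
  define \<rho> where "\<rho> k l = C * (4 / q) powr a * (\<Prod>i\<in>UNIV. (1 + \<bar>real (k i) - real (l i)\<bar>) powr (- b))"
    for k l :: "'n \<Rightarrow> nat"
  define R where "R = C * (4 / q) powr a * (2 / (1 - b) * real L powr (1 - b)) ^ CARD('n)"
  have C: "0 \<le> C"
    by (rule fourier_decay_imp_nonneg) fact
  have \<rho>_nonneg: "0 \<le> \<rho> k l" for k l
    unfolding \<rho>_def using C by (intro mult_nonneg_nonneg prod_nonneg) auto
  have off_diagonal: "norm (if k = l then 0 else fourier_transform \<mu> (\<xi> - q *\<^sub>R (nat_vec k - nat_vec l))) \<le> \<rho> k l"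
    for k l :: "'n \<Rightarrow> nat"
    using \<rho>_nonneg[of k l] norm_fourier_transform_shift_le[OF decay(1,2) q, of k l]
    by (cases "k = l") (simp_all add: \<rho>_def b_def)
  have row_sum: "(\<Sum>l\<in>index_box L. \<rho> k l) \<le> R" if "k \<in> index_box L" for k
    unfolding \<rho>_def R_def sum_distrib_left[symmetric] using C that b
    by (intro mult_left_mono sum_index_box_powr_le) auto
  have "norm (fourier_transform (density \<mu> (\<lambda>x. trig_density s L (q *\<^sub>R x))) \<xi> - fourier_transform \<mu> \<xi>)
      \<le> (\<Sum>k\<in>index_box L. \<Sum>l\<in>index_box L. \<bar>s k * s l\<bar> * \<rho> k l) / energy s L"
    unfolding fourier_transform_trig_density_diff[OF \<mu> energy] norm_divide norm_of_real abs_of_nonneg[OF energy_nonneg]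
    by (intro divide_right_mono energy_nonneg sum_norm_le)
       (simp add: norm_mult off_diagonal mult_left_mono del: of_real_mult)
  also have "\<dots> \<le> R * energy s L / energy s L"
    unfolding energy_def
    by (intro divide_right_mono schur_test sum_nonneg \<rho>_nonneg row_sum) (auto simp: \<rho>_def abs_minus_commute)
  also have "R * energy s L / energy s L = R"
    using energy by simp
  also have "R = C * (4 / q) powr a * (2 / (1 - b)) ^ CARD('n) * real L powr (real CARD('n) - a)"
    unfolding R_def power_mult_distrib using b(3) by (cases "L = 0") (simp_all add: powr_power)
  finally show ?thesis
    by (simp only: b_def)
qed

lemma norm_fourier_transform_trig_density_diff_le_powr:
  fixes \<mu> :: "(real ^ 'n) measure"
  defines "n \<equiv> real CARD('n)"
  assumes \<mu>: "borel_finite_measure \<mu>" and decay: "fourier_decay C a \<mu>" "0 \<le> a" "a < n"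
    and m: "m > 0" "2 * norm \<xi> \<le> real m" and energy: "energy s (B * m) \<noteq> 0"
  shows "norm (fourier_transform (density \<mu> (\<lambda>x. trig_density s (B * m) (real m ^ CARD('n) *\<^sub>R x))) \<xi>
      - fourier_transform \<mu> \<xi>)
    \<le> C * (4 powr a * (2 / (1 - a / n)) ^ CARD('n) * real B powr (n - a)) * real m powr (n - a - n * a)"
proof -
  have "real m \<le> real m ^ CARD('n)"
    using m(1) by (intro self_le_power) auto
  with m have q: "0 < real m ^ CARD('n)" "2 * norm \<xi> \<le> real m ^ CARD('n)"
    by (simp, linarith)
  have "real m ^ CARD('n) = real m powr n"
    using m(1) by (simp add: n_def powr_realpow)
  then have "(4 / real m ^ CARD('n)) powr a = 4 powr a * real m powr (- (n * a))"
    by (simp add: powr_divide powr_powr powr_minus_divide)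
  moreover have "real (B * m) powr (n - a) = real B powr (n - a) * real m powr (n - a)"
    by (simp add: powr_mult)
  moreover have "real m powr (n - a - n * a) = real m powr (- (n * a)) * real m powr (n - a)"
    by (simp flip: powr_add)
  ultimately show ?thesis
    using norm_fourier_transform_trig_density_diff_le[OF \<mu> decay(1,2) _ q energy] decay(3)
    unfolding n_def[symmetric] by (simp only: mult_ac)
qed

lemma fourier_transform_trig_density_tendsto:
  fixes \<mu> :: "(real ^ 'n) measure" and s :: "nat \<Rightarrow> ('n \<Rightarrow> nat) \<Rightarrow> real"
  assumes \<mu>: "borel_finite_measure \<mu>" and decay: "fourier_decay C a \<mu>"
    and a: "real CARD('n) / (real CARD('n) + 1) < a" "a < real CARD('n)"
    and energy: "\<And>m. m > 0 \<Longrightarrow> energy (s m) (B * m) \<noteq> 0"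
  shows "(\<lambda>m. fourier_transform (density \<mu> (\<lambda>x. trig_density (s m) (B * m) (real m ^ CARD('n) *\<^sub>R x))) \<xi>)
    \<longlonglongrightarrow> fourier_transform \<mu> \<xi>"
proof (rule LIM_zero_cancel)
  define n where "n = real CARD('n)"
  define E where "E = C * (4 powr a * (2 / (1 - a / n)) ^ CARD('n) * real B powr (n - a))"
  have "0 \<le> n / (n + 1)"
    by (simp add: n_def)
  with a have a_nonneg: "0 \<le> a"
    unfolding n_def by linarith
  obtain N :: nat where N: "2 * norm \<xi> \<le> real N"
    using real_arch_simple by blast
  show "(\<lambda>m. fourier_transform (density \<mu> (\<lambda>x. trig_density (s m) (B * m) (real m ^ CARD('n) *\<^sub>R x))) \<xi>
    - fourier_transform \<mu> \<xi>) \<longlonglongrightarrow> 0"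
  proof (rule Lim_null_comparison)
    show "eventually (\<lambda>m. norm (fourier_transform
        (density \<mu> (\<lambda>x. trig_density (s m) (B * m) (real m ^ CARD('n) *\<^sub>R x))) \<xi> - fourier_transform \<mu> \<xi>)
        \<le> E * real m powr (n - a - n * a)) sequentially"
      unfolding E_def n_def using N a(2)
      by (intro eventually_sequentiallyI[of "max 1 N"]
          norm_fourier_transform_trig_density_diff_le_powr \<mu> decay a_nonneg energy) auto
    have "n - a - n * a < 0"
      using a(1) by (simp add: n_def field_simps)
    then show "(\<lambda>m. E * real m powr (n - a - n * a)) \<longlonglongrightarrow> 0"
      by (intro tendsto_mult_right_zero tendsto_neg_powr filterlim_real_sequentially)
  qed
qed

lemma integral_trig_density_tendsto:
  fixes \<mu> :: "(real ^ 'n) measure" and s :: "nat \<Rightarrow> ('n \<Rightarrow> nat) \<Rightarrow> real"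
  assumes \<mu>: "borel_finite_measure_on \<mu> K" and decay: "fourier_decay C a \<mu>"
    and a: "real CARD('n) / (real CARD('n) + 1) < a" "a < real CARD('n)"
    and energy: "\<And>m. m > 0 \<Longrightarrow> energy (s m) (B * m) \<noteq> 0"
    and f: "continuous_on UNIV f"
  shows "(\<lambda>m. \<integral>x. f x * trig_density (s m) (B * m) (real m ^ CARD('n) *\<^sub>R x) \<partial>\<mu>) \<longlonglongrightarrow> (\<integral>x. f x \<partial>\<mu> :: real)"
proof -
  interpret borel_finite_measure_on \<mu> K by fact
  define h where "h m x = trig_density (s m) (B * m) (real m ^ CARD('n) *\<^sub>R x)" for m x
  have h: "continuous_on UNIV (h m)" "0 \<le> h m x" for m x
    unfolding h_def by (intro continuous_intros trig_density_nonneg)+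
  have "(\<lambda>m. \<integral>x. f x \<partial>density \<mu> (h m)) \<longlonglongrightarrow> (\<integral>x. f x \<partial>\<mu>)"
  proof (rule tendsto_integral_if_fourier_transform_tendsto[OF \<mu> _ _ f])
    show "borel_finite_measure_on (density \<mu> (h m)) K" for m
      by (intro borel_finite_measure_on_density h)
    show "(\<lambda>m. fourier_transform (density \<mu> (h m)) \<xi>) \<longlonglongrightarrow> fourier_transform \<mu> \<xi>" for \<xi>
      unfolding h_def using borel_finite_measure_axioms decay a energy
      by (rule fourier_transform_trig_density_tendsto)
  qed
  also have "(\<lambda>m. \<integral>x. f x \<partial>density \<mu> (h m)) = (\<lambda>m. \<integral>x. f x * h m x \<partial>\<mu>)"
    using h f by (simp add: integral_density_continuous mult.commute)
  finally show ?thesis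
    by (simp only: h_def)
qed

subsection \<open>Tent coefficients and the distance to the lattice\<close>

lemma jordan_inequality_sin:
  assumes "0 \<le> x" "x \<le> pi / 2"
  shows "2 * x / pi \<le> sin x"
proof -
  have "concave_on {0..pi} sin"
    by (rule f''_le0_imp_concave[where f'=cos and f''="\<lambda>x. - sin x"])
       (auto intro!: derivative_eq_intros sin_ge_zero)
  from concave_onD[OF this, of "2 * x / pi" 0 "pi / 2"] assms show ?thesis
    by (auto simp: field_simps)
qed

lemma norm_one_minus_cis_ge: "4 * \<bar>t - of_int (round t)\<bar> \<le> norm (1 - cis (2 * pi * t))"
proof -
  define r where "r = t - of_int (round t)"
  have r: "\<bar>r\<bar> \<le> 1 / 2"
    using of_int_round_abs_le[of t] by (simp add: r_def abs_minus_commute)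
  have "cis (2 * pi * t) = cis (2 * pi * r) * cis (2 * pi * of_int (round t))"
    by (simp add: cis_mult r_def algebra_simps del: cis_multiple_2pi)
  then have "cis (2 * pi * t) = cis (2 * pi * r)"
    by simp
  then have "norm (1 - cis (2 * pi * t)) = 2 * \<bar>sin (pi * r)\<bar>"
    using dist_exp_i_1[of "2 * pi * r"] by (simp add: cis_conv_exp norm_minus_commute)
  moreover have "\<bar>sin (pi * r)\<bar> = \<bar>sin (pi * \<bar>r\<bar>)\<bar>"
    by (simp add: abs_if)
  moreover have "2 * \<bar>r\<bar> \<le> \<bar>sin (pi * \<bar>r\<bar>)\<bar>"
    using jordan_inequality_sin[of "pi * \<bar>r\<bar>"] r by (auto simp: mult_left_le)
  ultimately show ?thesis
    by (simp add: r_def)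
qed

lemma nearest_int_dist_nonneg: "0 \<le> nearest_int_dist y"
  by (simp add: nearest_int_dist_def infdist_nonneg)

lemma nearest_int_dist_sq_le:
  fixes y :: "real ^ 'n"
  shows "16 * (nearest_int_dist y)\<^sup>2 \<le> (\<Sum>i\<in>UNIV. (norm (1 - cis (2 * pi * y $ i)))\<^sup>2)"
proof -
  define z :: "real ^ 'n" where "z = (\<chi> i. of_int (round (y $ i)))"
  have "z \<in> int_lattice"
    by (simp add: z_def int_lattice_def)
  then have "nearest_int_dist y \<le> dist y z"
    unfolding nearest_int_dist_def by (rule infdist_le)
  then have "(nearest_int_dist y)\<^sup>2 \<le> (dist y z)\<^sup>2"
    by (intro power_mono nearest_int_dist_nonneg)
  also have "\<dots> = (\<Sum>i\<in>UNIV. (y $ i - of_int (round (y $ i)))\<^sup>2)"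
    by (simp add: dist_norm norm_vec_def L2_set_def z_def sum_nonneg)
  finally have "16 * (nearest_int_dist y)\<^sup>2 \<le> (\<Sum>i\<in>UNIV. (4 * \<bar>y $ i - of_int (round (y $ i))\<bar>)\<^sup>2)"
    by (simp add: power_mult_distrib flip: sum_distrib_left)
  also have "\<dots> \<le> (\<Sum>i\<in>UNIV. (norm (1 - cis (2 * pi * y $ i)))\<^sup>2)"
    by (intro sum_mono power_mono norm_one_minus_cis_ge) auto
  finally show ?thesis .
qed

definition forward_diff :: "(nat \<Rightarrow> real) \<Rightarrow> nat \<Rightarrow> real" where
  "forward_diff s j = s (Suc j) - s j"

definition tensor :: "('n::finite \<Rightarrow> nat \<Rightarrow> real) \<Rightarrow> ('n \<Rightarrow> nat) \<Rightarrow> real" where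
  "tensor \<sigma> k = (\<Prod>i\<in>UNIV. \<sigma> i (k i))"

lemma prod_fun_upd:
  fixes \<sigma> :: "'n::finite \<Rightarrow> 'b" and g :: "'n \<Rightarrow> 'b \<Rightarrow> 'c::comm_monoid_mult"
  shows "(\<Prod>l\<in>UNIV. g l ((\<sigma>(i := \<tau>)) l)) = g i \<tau> * (\<Prod>l\<in>UNIV - {i}. g l (\<sigma> l))"
  by (simp add: prod.remove[of UNIV i])

lemma trig_sum_tensor:
  "trig_sum (tensor \<sigma>) L x = (\<Prod>i\<in>UNIV. \<Sum>j<L. of_real (\<sigma> i j) * cis (2 * pi * (real j * x $ i)))"
proof -
  have cis_sum: "cis (\<Sum>i\<in>A. f i) = (\<Prod>i\<in>A. cis (f i))" if "finite A" for f :: "'a \<Rightarrow> real" and A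
    using that by induction (simp_all flip: cis_mult)
  have "char_fun (nat_vec k) x = (\<Prod>i\<in>UNIV. cis (2 * pi * (real (k i) * x $ i)))" for k
    by (simp add: char_fun_def nat_vec_def inner_vec_def sum_distrib_left cis_sum)
  then show ?thesis
    by (simp add: trig_sum_def tensor_def prod.distrib flip: sum_index_box_prod)
qed

lemma energy_tensor: "energy (tensor \<sigma>) L = (\<Prod>i\<in>UNIV. \<Sum>j<L. (\<sigma> i j)\<^sup>2)"
  by (simp add: energy_def tensor_def prod_power_distrib flip: sum_index_box_prod)

lemma norm_sum_forward_diff_cis:
  assumes "s 0 = 0" "s L = 0"
  shows "norm (\<Sum>j<L. of_real (forward_diff s j) * cis (2 * pi * (real j * u))) =
         norm (1 - cis (2 * pi * u)) * norm (\<Sum>j<L. of_real (s j) * cis (2 * pi * (real j * u)))"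
proof -
  define w where "w = cis (2 * pi * u)"
  have w: "cis (2 * pi * (real j * u)) = w ^ j" for j
    by (simp add: w_def Complex.DeMoivre mult_ac)
  have "w * (\<Sum>j<N. of_real (forward_diff s j) * w ^ j) =
      (1 - w) * (\<Sum>j<N. of_real (s j) * w ^ j) - of_real (s 0) + of_real (s N) * w ^ N" for N
    by (induction N) (simp_all add: forward_diff_def algebra_simps)
  then have "w * (\<Sum>j<L. of_real (forward_diff s j) * w ^ j) = (1 - w) * (\<Sum>j<L. of_real (s j) * w ^ j)"
    using assms by simp
  from arg_cong[OF this, of norm] show ?thesis
    unfolding w by (simp add: norm_mult w_def)
qed

lemma trig_density_tensor_forward_diff:
  fixes \<sigma> :: "'n::finite \<Rightarrow> nat \<Rightarrow> real"
  assumes "\<sigma> i 0 = 0" "\<sigma> i L = 0" "(\<Sum>j<L. (forward_diff (\<sigma> i) j)\<^sup>2) \<noteq> 0"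
  shows "(norm (1 - cis (2 * pi * y $ i)))\<^sup>2 * trig_density (tensor \<sigma>) L y =
    (\<Sum>j<L. (forward_diff (\<sigma> i) j)\<^sup>2) / (\<Sum>j<L. (\<sigma> i j)\<^sup>2) *
    trig_density (tensor (\<sigma>(i := forward_diff (\<sigma> i)))) L y"
proof -
  define F where "F l s = norm (\<Sum>j<L. of_real (s j) * cis (2 * pi * (real j * y $ l)))" for s l
  define V where "V s = (\<Sum>j<L. (s j)\<^sup>2)" for s :: "nat \<Rightarrow> real"
  have F: "norm (trig_sum (tensor (\<sigma>(i := s))) L y) = F i s * (\<Prod>l\<in>UNIV - {i}. F l (\<sigma> l))" for s
    unfolding trig_sum_tensor prod_norm[symmetric] F_def[symmetric] by (rule prod_fun_upd[where g=F])
  have V: "energy (tensor (\<sigma>(i := s))) L = V s * (\<Prod>l\<in>UNIV - {i}. V (\<sigma> l))" for s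
    unfolding energy_tensor V_def[symmetric] by (rule prod_fun_upd[where g="\<lambda>_. V"])
  have "F i (forward_diff (\<sigma> i)) = norm (1 - cis (2 * pi * y $ i)) * F i (\<sigma> i)"
    unfolding F_def by (rule norm_sum_forward_diff_cis) fact+
  moreover have "V (forward_diff (\<sigma> i)) \<noteq> 0"
    using assms(3) by (simp add: V_def)
  ultimately have "(norm (1 - cis (2 * pi * y $ i)))\<^sup>2 * trig_density (tensor (\<sigma>(i := \<sigma> i))) L y =
      V (forward_diff (\<sigma> i)) / V (\<sigma> i) * trig_density (tensor (\<sigma>(i := forward_diff (\<sigma> i)))) L y"
    unfolding trig_density_def F V by (simp add: power_mult_distrib)
  then show ?thesis
    by (simp add: V_def)
qed

definition tent :: "nat \<Rightarrow> nat \<Rightarrow> real" where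
  "tent M j = real M - \<bar>real M - real j\<bar>"

lemma sum_tent_sq_ge: "real M ^ 3 / 3 \<le> (\<Sum>j<2 * M. (tent M j)\<^sup>2)"
proof (cases "M = 0")
  case False
  have "real N ^ 3 / 3 \<le> (\<Sum>j\<le>N. (real j)\<^sup>2)" for N
    by (induction N) (simp_all add: power2_eq_square power3_eq_cube field_simps)
  also have "(\<Sum>j\<le>M. (real j)\<^sup>2) = (\<Sum>j\<le>M. (tent M j)\<^sup>2)"
    by (intro sum.cong) (auto simp: tent_def)
  also have "\<dots> \<le> (\<Sum>j<2 * M. (tent M j)\<^sup>2)"
    using False by (intro sum_mono2) auto
  finally show ?thesis .
qed simp

lemma sum_forward_diff_tent_sq: "(\<Sum>j<2 * M. (forward_diff (tent M) j)\<^sup>2) = 2 * real M"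
proof -
  have "(forward_diff (tent M) j)\<^sup>2 = 1" if "j < 2 * M" for j
    using that by (cases "j < M") (auto simp: forward_diff_def tent_def)
  then show ?thesis
    by simp
qed

definition tent_density :: "nat \<Rightarrow> real ^ 'n \<Rightarrow> real" where
  "tent_density M = trig_density (tensor (\<lambda>_. tent M)) (2 * M)"

definition tent_diff_density :: "nat \<Rightarrow> 'n \<Rightarrow> real ^ 'n \<Rightarrow> real" where
  "tent_diff_density M i = trig_density (tensor ((\<lambda>_. tent M)(i := forward_diff (tent M)))) (2 * M)"

lemma tent_density_nonneg: "0 \<le> tent_density M y"
  and tent_diff_density_nonneg: "0 \<le> tent_diff_density M i y"
  by (simp_all add: tent_density_def tent_diff_density_def trig_density_nonneg)

lemma continuous_on_tent_density [continuous_intros]: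
    "continuous_on A f \<Longrightarrow> continuous_on A (\<lambda>x. tent_density M (f x))"
  and continuous_on_tent_diff_density [continuous_intros]:
    "continuous_on A f \<Longrightarrow> continuous_on A (\<lambda>x. tent_diff_density M i (f x))"
  unfolding tent_density_def tent_diff_density_def by (auto intro: continuous_on_trig_density)

lemma one_minus_cis_mult_tent_density:
  fixes y :: "real ^ 'n"
  assumes "M > 0"
  shows "(norm (1 - cis (2 * pi * y $ i)))\<^sup>2 * tent_density M y =
    2 * real M / (\<Sum>j<2 * M. (tent M j)\<^sup>2) * tent_diff_density M i y"
  unfolding tent_density_def tent_diff_density_def
  using assms trig_density_tensor_forward_diff[of "\<lambda>_. tent M" i "2 * M" y]
  by (simp add: sum_forward_diff_tent_sq tent_def[of M 0] tent_def[of M "2 * M"])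

lemma tent_density_le:
  fixes y :: "real ^ 'n"
  assumes "M > 0"
  shows "(real M * nearest_int_dist y)\<^sup>2 * tent_density M y \<le> 1 / 2 * (\<Sum>i\<in>UNIV. tent_diff_density M i y)"
proof -
  define V where "V = (\<Sum>j<2 * M. (tent M j)\<^sup>2)"
  define e where "e i = (norm (1 - cis (2 * pi * y $ i)))\<^sup>2" for i
  have "2 * real M / V \<le> 2 * real M / (real M ^ 3 / 3)"
    unfolding V_def using assms
    by (intro divide_left_mono sum_tent_sq_ge mult_pos_pos less_le_trans[OF _ sum_tent_sq_ge]) auto
  also have "\<dots> = 6 / (real M)\<^sup>2"
    using assms by (simp add: power2_eq_square power3_eq_cube)
  finally have "2 * real M / V * tent_diff_density M i y \<le> 6 / (real M)\<^sup>2 * tent_diff_density M i y" for i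
    by (intro mult_right_mono tent_diff_density_nonneg)
  then have e_le: "e i * tent_density M y \<le> 6 / (real M)\<^sup>2 * tent_diff_density M i y" for i
    using one_minus_cis_mult_tent_density[OF assms, of y i] by (simp add: e_def V_def)
  have "16 * (nearest_int_dist y)\<^sup>2 * tent_density M y \<le> (\<Sum>i\<in>UNIV. e i) * tent_density M y"
    unfolding e_def by (intro mult_right_mono nearest_int_dist_sq_le tent_density_nonneg)
  also have "\<dots> \<le> 6 / (real M)\<^sup>2 * (\<Sum>i\<in>UNIV. tent_diff_density M i y)"
    unfolding sum_distrib_left sum_distrib_right by (intro sum_mono e_le)
  finally have "(real M * nearest_int_dist y)\<^sup>2 * tent_density M y \<le> 3 / 8 * (\<Sum>i\<in>UNIV. tent_diff_density M i y)"
    using assms by (simp add: power_mult_distrib field_simps)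
  also have "\<dots> \<le> 1 / 2 * (\<Sum>i\<in>UNIV. tent_diff_density M i y)"
    by (intro mult_right_mono sum_nonneg tent_diff_density_nonneg) simp
  finally show ?thesis .
qed

lemma integral_tent_density_tendsto:
  fixes \<mu> :: "(real ^ 'n) measure" and f :: "real ^ 'n \<Rightarrow> real"
  assumes "borel_finite_measure_on \<mu> K" "fourier_decay C a \<mu>"
    and "real CARD('n) / (real CARD('n) + 1) < a" "a < real CARD('n)"
    and f: "continuous_on UNIV f" and "A > 0"
  shows "(\<lambda>m. \<integral>x. f x * tent_density (A * m) (real m ^ CARD('n) *\<^sub>R x) \<partial>\<mu>) \<longlonglongrightarrow> (\<integral>x. f x \<partial>\<mu>)" (is ?tent)
    and "(\<lambda>m. \<integral>x. f x * tent_diff_density (A * m) i (real m ^ CARD('n) *\<^sub>R x) \<partial>\<mu>) \<longlonglongrightarrow> (\<integral>x. f x \<partial>\<mu>)" (is ?diff)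
proof -
  have V: "0 < (\<Sum>j<2 * M. (tent M j)\<^sup>2)" if "M > 0" for M
    using that by (intro less_le_trans[OF _ sum_tent_sq_ge]) simp
  have "energy (tensor (\<lambda>_ :: 'n. tent (A * m))) (2 * A * m) \<noteq> 0"
    and "energy (tensor ((\<lambda>_. tent (A * m))(i := forward_diff (tent (A * m))))) (2 * A * m) \<noteq> 0" if "m > 0" for m
    using V[of "A * m"] that \<open>A > 0\<close>
    by (auto simp: energy_tensor sum_forward_diff_tent_sq mult.assoc)
  note lim = this[THEN integral_trig_density_tendsto[OF assms(1-4) _ f]]
  show ?tent
    using lim(1) by (simp add: tent_density_def mult.assoc)
  show ?diff
    using lim(2) by (simp add: tent_diff_density_def mult.assoc)
qed

subsection \<open>Supports and closed covers\<close>

lemma AE_in_measure_support: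
  fixes \<mu> :: "'a::second_countable_topology measure"
  assumes sets: "sets \<mu> = sets borel"
  shows "AE x in \<mu>. x \<in> measure_support \<mu>"
proof -
  define \<F> where "\<F> = {U. open U \<and> emeasure \<mu> U = 0}"
  obtain \<F>' where \<F>': "\<F>' \<subseteq> \<F>" "countable \<F>'" "\<Union>\<F>' = \<Union>\<F>"
    using Lindelof[of \<F>] by (auto simp: \<F>_def)
  have "(\<Union>U\<in>\<F>'. U) \<in> null_sets \<mu>"
    using \<F>' by (intro null_sets_UN') (auto simp: \<F>_def null_sets_def sets)
  moreover have "{x \<in> space \<mu>. x \<notin> measure_support \<mu>} \<subseteq> (\<Union>U\<in>\<F>'. U)"
    using \<F>'(3) by (auto simp: \<F>_def measure_support_def)
  ultimately show ?thesis
    by (intro AE_I') auto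
qed

lemma borel_finite_measure_on_support:
  fixes \<mu> :: "'a::second_countable_topology measure"
  assumes "\<mu> \<in> compact_prob_measures E"
  shows "borel_finite_measure_on \<mu> (measure_support \<mu>)"
proof -
  interpret prob_space \<mu>
    using assms by (simp add: compact_prob_measures_def)
  show ?thesis
    using assms by unfold_locales (auto simp: compact_prob_measures_def intro: AE_in_measure_support)
qed

lemma measure_support_nonempty:
  fixes \<mu> :: "'a::second_countable_topology measure"
  assumes "prob_space \<mu>" "sets \<mu> = sets borel"
  shows "measure_support \<mu> \<noteq> {}"
proof -
  interpret prob_space \<mu> by fact
  show ?thesis
    using AE_in_measure_support[OF assms(2)] by (auto simp: AE_False)
qed

lemma (in borel_finite_measure_on) integral_pos_if_pos_on_support:
  fixes f :: "'a \<Rightarrow> real"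
  assumes f: "continuous_on UNIV f" "\<And>x. 0 \<le> f x" and x: "x \<in> measure_support \<mu>" "0 < f x"
  shows "0 < (\<integral>x. f x \<partial>\<mu>)"
proof -
  have "open {y. 0 < f y}"
    using f(1) by (intro open_Collect_less continuous_on_const)
  then have "0 < emeasure \<mu> {y. 0 < f y}" and sets: "{y. 0 < f y} \<in> sets \<mu>"
    using x by (auto simp: measure_support_def sets_eq_borel)
  then have "\<not> (AE y in \<mu>. f y = 0)"
    using AE_iff_measurable[OF sets, of "\<lambda>y. f y = 0"] f(2) sets_eq_imp_space_eq[OF sets_eq_borel]
    by (auto simp: less_le)
  then have "(\<integral>x. f x \<partial>\<mu>) \<noteq> 0"
    using f by (simp add: integral_nonneg_eq_0_iff_AE integrable_continuous)
  then show ?thesis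
    using f(2) by (simp add: less_le)
qed

lemma Baire_closed_cover:
  fixes K :: "'a::complete_space set" and F :: "nat \<Rightarrow> 'a set"
  assumes "closed K" "K \<noteq> {}" "K \<subseteq> (\<Union>j. F j)" "\<And>j. closed (F j)"
  obtains j x r where "x \<in> K" "r > 0" "K \<inter> ball x r \<subseteq> F j"
proof -
  let ?X = "top_of_set K"
  have "\<exists>j. ?X interior_of (K \<inter> F j) \<noteq> {}"
  proof (rule ccontr)
    assume "\<nexists>j. ?X interior_of (K \<inter> F j) \<noteq> {}"
    then have "?X interior_of \<Union>(range (\<lambda>j. K \<inter> F j)) = {}"
      using assms(1,4)
      by (intro Baire_category_alt disjI1 completely_metrizable_space_closedin completely_metrizable_space_euclidean)
         (auto simp: closedin_closed_Int)
    moreover have "\<Union>(range (\<lambda>j. K \<inter> F j)) = topspace ?X"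
      using assms(3) by auto
    ultimately show False
      using assms(2) by (metis interior_of_topspace topspace_euclidean_subtopology)
  qed
  then obtain j x where x: "x \<in> ?X interior_of (K \<inter> F j)"
    by blast
  have "openin ?X (?X interior_of (K \<inter> F j))"
    by (rule openin_interior_of)
  then obtain r where "r > 0" "ball x r \<inter> K \<subseteq> ?X interior_of (K \<inter> F j)"
    using x unfolding openin_contains_ball by blast
  moreover have "?X interior_of (K \<inter> F j) \<subseteq> K \<inter> F j"
    by (rule interior_of_subset)
  ultimately show ?thesis
    using x by (intro that[of x r j]) auto
qed

subsection \<open>Badly approximable vectors\<close>

definition Bad_const :: "real \<Rightarrow> (real ^ 'n) set" where
  "Bad_const c = {x. \<forall>q::nat. q \<ge> 1 \<longrightarrow>
     c * real q powr (- 1 / real CARD('n)) \<le> nearest_int_dist (real q *\<^sub>R x)}"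

lemma closed_Bad_const: "closed (Bad_const c :: (real ^ 'n) set)"
proof -
  have "Bad_const c = (\<Inter>q\<in>{1..}. {x :: real ^ 'n.
      c * real q powr (- 1 / real CARD('n)) \<le> infdist (real q *\<^sub>R x) int_lattice})"
    by (auto simp: Bad_const_def nearest_int_dist_def)
  also have "closed \<dots>"
    by (intro closed_INT ballI closed_Collect_le continuous_intros)
  finally show ?thesis .
qed

lemma Bad_const_antimono:
  assumes "c \<le> d"
  shows "Bad_const d \<subseteq> Bad_const c"
  using assms by (auto simp: Bad_const_def intro: order_trans[OF mult_right_mono])

lemma Bad_eq_Union_Bad_const: "Bad = (\<Union>j. Bad_const (1 / real (Suc j)) :: (real ^ 'n) set)"
proof (intro equalityI subsetI)
  fix x :: "real ^ 'n" assume "x \<in> Bad"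
  then obtain c where c: "c > 0" "x \<in> Bad_const c"
    by (auto simp: Bad_def Bad_const_def)
  obtain j where "1 / real (Suc j) < c"
    using c(1) by (rule nat_approx_posE)
  then have "Bad_const c \<subseteq> (Bad_const (1 / real (Suc j)) :: (real ^ 'n) set)"
    by (intro Bad_const_antimono) simp
  with c(2) show "x \<in> (\<Union>j. Bad_const (1 / real (Suc j)))"
    by blast
next
  fix x :: "real ^ 'n" assume "x \<in> (\<Union>j. Bad_const (1 / real (Suc j)))"
  then obtain j where "x \<in> Bad_const (1 / real (Suc j))"
    by blast
  then show "x \<in> Bad"
    unfolding Bad_def Bad_const_def by (intro CollectI exI[of _ "1 / real (Suc j)"]) simp
qed

lemma Bad_const_nearest_int_dist_ge:
  fixes x :: "real ^ 'n"
  assumes "x \<in> Bad_const c" "m > 0"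
  shows "c \<le> real m * nearest_int_dist (real m ^ CARD('n) *\<^sub>R x)"
proof -
  have "real (m ^ CARD('n)) = real m powr real CARD('n)"
    using assms(2) by (simp add: powr_realpow)
  then have "real (m ^ CARD('n)) powr (- 1 / real CARD('n)) = 1 / real m"
    using assms(2) by (simp add: powr_powr powr_minus_divide)
  moreover have "1 \<le> m ^ CARD('n)"
    using assms(2) by simp
  then have "c * real (m ^ CARD('n)) powr (- 1 / real CARD('n)) \<le> nearest_int_dist (real (m ^ CARD('n)) *\<^sub>R x)"
    using assms(1) unfolding Bad_const_def by blast
  ultimately have "c * (1 / real m) \<le> nearest_int_dist (real m ^ CARD('n) *\<^sub>R x)"
    by simp
  then show ?thesis
    using assms(2) by (simp add: field_simps)
qed

lemma Bad_const_tent_density_le: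
  fixes x :: "real ^ 'n"
  assumes "x \<in> Bad_const c" "c > 0" "A > 0" "m > 0"
  shows "(real A * c)\<^sup>2 * tent_density (A * m) (real m ^ CARD('n) *\<^sub>R x)
    \<le> 1 / 2 * (\<Sum>i\<in>UNIV. tent_diff_density (A * m) i (real m ^ CARD('n) *\<^sub>R x))"
proof -
  define y where "y = real m ^ CARD('n) *\<^sub>R x"
  have "real A * c \<le> real (A * m) * nearest_int_dist y"
    using Bad_const_nearest_int_dist_ge[OF assms(1,4)] \<open>A > 0\<close> by (simp add: y_def)
  then have "(real A * c)\<^sup>2 \<le> (real (A * m) * nearest_int_dist y)\<^sup>2"
    using \<open>c > 0\<close> by (intro power_mono) auto
  then have "(real A * c)\<^sup>2 * tent_density (A * m) y \<le> (real (A * m) * nearest_int_dist y)\<^sup>2 * tent_density (A * m) y"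
    by (intro mult_right_mono tent_density_nonneg)
  also have "\<dots> \<le> 1 / 2 * (\<Sum>i\<in>UNIV. tent_diff_density (A * m) i y)"
    using assms by (intro tent_density_le) simp
  finally show ?thesis
    by (simp only: y_def)
qed

lemma integral_tent_density_le_if_vanishing_off_Bad_const:
  fixes \<mu> :: "(real ^ 'n) measure" and f :: "real ^ 'n \<Rightarrow> real"
  assumes "borel_finite_measure_on \<mu> K" and f: "continuous_on UNIV f" "\<And>x. 0 \<le> f x"
    and vanishing: "\<And>x. x \<in> K \<Longrightarrow> x \<notin> Bad_const c \<Longrightarrow> f x = 0"
    and pos: "c > 0" "A > 0" "m > 0"
  shows "(real A * c)\<^sup>2 * (\<integral>x. f x * tent_density (A * m) (real m ^ CARD('n) *\<^sub>R x) \<partial>\<mu>)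
    \<le> 1 / 2 * (\<Sum>i\<in>UNIV. \<integral>x. f x * tent_diff_density (A * m) i (real m ^ CARD('n) *\<^sub>R x) \<partial>\<mu>)"
proof -
  interpret borel_finite_measure_on \<mu> K by fact
  define S where "S x = tent_density (A * m) (real m ^ CARD('n) *\<^sub>R x)" for x :: "real ^ 'n"
  define T where "T i x = tent_diff_density (A * m) i (real m ^ CARD('n) *\<^sub>R x)" for i and x :: "real ^ 'n"
  have int: "integrable \<mu> (\<lambda>x. f x * S x)" "integrable \<mu> (\<lambda>x. f x * T i x)" for i
    unfolding S_def T_def by (intro integrable_continuous continuous_intros f(1))+
  have "(real A * c)\<^sup>2 * (f x * S x) \<le> 1 / 2 * (\<Sum>i\<in>UNIV. f x * T i x)" if "x \<in> K" for x
  proof (cases "x \<in> Bad_const c")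
    case True
    then have "(real A * c)\<^sup>2 * S x \<le> 1 / 2 * (\<Sum>i\<in>UNIV. T i x)"
      unfolding S_def T_def using pos by (rule Bad_const_tent_density_le)
    from mult_left_mono[OF this f(2)[of x]] show ?thesis
      by (simp only: sum_distrib_left mult.left_commute[of "f x"])
  qed (use vanishing that in simp)
  then have "(\<integral>x. (real A * c)\<^sup>2 * (f x * S x) \<partial>\<mu>) \<le> (\<integral>x. 1 / 2 * (\<Sum>i\<in>UNIV. f x * T i x) \<partial>\<mu>)"
    by (intro integral_mono_AE integrable_mult_right Bochner_Integration.integrable_sum int
        eventually_mono[OF AE_carrier])
  then show ?thesis
    by (simp add: int flip: S_def T_def)
qed

lemma integral_le_if_vanishing_off_Bad_const:
  fixes \<mu> :: "(real ^ 'n) measure" and f :: "real ^ 'n \<Rightarrow> real"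
  assumes \<mu>: "borel_finite_measure_on \<mu> K" and decay: "fourier_decay C a \<mu>"
    and a: "real CARD('n) / (real CARD('n) + 1) < a" "a < real CARD('n)"
    and f: "continuous_on UNIV f" "\<And>x. 0 \<le> f x"
    and vanishing: "\<And>x. x \<in> K \<Longrightarrow> x \<notin> Bad_const c \<Longrightarrow> f x = 0" and pos: "c > 0" "A > 0"
  shows "(real A * c)\<^sup>2 * (\<integral>x. f x \<partial>\<mu>) \<le> real CARD('n) / 2 * (\<integral>x. f x \<partial>\<mu>)"
proof (rule LIMSEQ_le)
  note lim = integral_tent_density_tendsto[OF \<mu> decay a f(1) pos(2)]
  show "(\<lambda>m. (real A * c)\<^sup>2 * (\<integral>x. f x * tent_density (A * m) (real m ^ CARD('n) *\<^sub>R x) \<partial>\<mu>))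
      \<longlonglongrightarrow> (real A * c)\<^sup>2 * (\<integral>x. f x \<partial>\<mu>)"
    by (intro tendsto_mult_left lim)
  have "(\<lambda>m. 1 / 2 * (\<Sum>i\<in>UNIV. \<integral>x. f x * tent_diff_density (A * m) i (real m ^ CARD('n) *\<^sub>R x) \<partial>\<mu>))
      \<longlonglongrightarrow> 1 / 2 * (\<Sum>i\<in>(UNIV :: 'n set). \<integral>x. f x \<partial>\<mu>)"
    by (intro tendsto_mult_left tendsto_sum lim)
  then show "(\<lambda>m. 1 / 2 * (\<Sum>i\<in>UNIV. \<integral>x. f x * tent_diff_density (A * m) i (real m ^ CARD('n) *\<^sub>R x) \<partial>\<mu>))
      \<longlonglongrightarrow> real CARD('n) / 2 * (\<integral>x. f x \<partial>\<mu>)"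
    by simp
  show "\<exists>N. \<forall>m\<ge>N. (real A * c)\<^sup>2 * (\<integral>x. f x * tent_density (A * m) (real m ^ CARD('n) *\<^sub>R x) \<partial>\<mu>)
      \<le> 1 / 2 * (\<Sum>i\<in>UNIV. \<integral>x. f x * tent_diff_density (A * m) i (real m ^ CARD('n) *\<^sub>R x) \<partial>\<mu>)"
    by (intro exI[of _ 1] allI impI integral_tent_density_le_if_vanishing_off_Bad_const[OF \<mu> f vanishing pos]) simp_all
qed

lemma integral_eq_0_if_vanishing_off_Bad_const:
  fixes \<mu> :: "(real ^ 'n) measure" and f :: "real ^ 'n \<Rightarrow> real"
  assumes \<mu>: "borel_finite_measure_on \<mu> K" and decay: "fourier_decay C a \<mu>"
    and a: "real CARD('n) / (real CARD('n) + 1) < a" "a < real CARD('n)"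
    and f: "continuous_on UNIV f" "\<And>x. 0 \<le> f x"
    and vanishing: "\<And>x. x \<in> K \<Longrightarrow> x \<notin> Bad_const c \<Longrightarrow> f x = 0" and "c > 0"
  shows "(\<integral>x. f x \<partial>\<mu>) = 0"
proof -
  define n where "n = real CARD('n)"
  have n: "n \<ge> 1"
    by (simp add: n_def Suc_leI)
  obtain A :: nat where "n / c < real A"
    using reals_Archimedean2 by blast
  then have A: "A > 0" "n \<le> real A * c"
    using \<open>c > 0\<close> n by (auto simp: field_simps intro!: Nat.gr0I)
  have "(real A * c)\<^sup>2 * (\<integral>x. f x \<partial>\<mu>) \<le> n / 2 * (\<integral>x. f x \<partial>\<mu>)"
    unfolding n_def by (rule integral_le_if_vanishing_off_Bad_const[OF \<mu> decay a f vanishing \<open>c > 0\<close> A(1)])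
  then have "((real A * c)\<^sup>2 - n / 2) * (\<integral>x. f x \<partial>\<mu>) \<le> 0"
    by (simp add: left_diff_distrib)
  moreover have "0 < (real A * c)\<^sup>2 - n / 2"
  proof -
    have "n < 2 * n\<^sup>2"
      using n by (simp add: power2_eq_square)
    also have "\<dots> \<le> 2 * (real A * c)\<^sup>2"
      using A(2) n by (intro mult_left_mono power_mono) auto
    finally show ?thesis
      by simp
  qed
  ultimately have "(\<integral>x. f x \<partial>\<mu>) \<le> 0"
    by (simp add: mult_le_0_iff)
  with f(2) show ?thesis
    by (simp add: order.antisym)
qed

lemma fourier_decay_exponent_le:
  fixes \<mu> :: "(real ^ 'n) measure"
  assumes \<mu>: "\<mu> \<in> compact_prob_measures Bad" and decay: "fourier_decay C a \<mu>" "a < real CARD('n)"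
  shows "a \<le> real CARD('n) / (real CARD('n) + 1)"
proof (rule ccontr)
  assume "\<not> ?thesis"
  then have a: "real CARD('n) / (real CARD('n) + 1) < a"
    by simp
  define K where "K = measure_support \<mu>"
  have "closed K" "K \<subseteq> Bad"
    using \<mu> by (simp_all add: K_def compact_prob_measures_def compact_imp_closed)
  moreover have "K \<noteq> {}"
    unfolding K_def using \<mu> by (intro measure_support_nonempty) (simp_all add: compact_prob_measures_def)
  ultimately obtain j x r where x: "x \<in> K" "r > 0" and sub: "K \<inter> ball x r \<subseteq> Bad_const (1 / real (Suc j))"
    using closed_Bad_const by (elim Baire_closed_cover) (unfold Bad_eq_Union_Bad_const)
  interpret borel_finite_measure_on \<mu> K
    unfolding K_def by (rule borel_finite_measure_on_support) fact
  define f where "f y = max 0 (r - dist y x)" for y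
  have f: "continuous_on UNIV f" "0 \<le> f y" for y
    unfolding f_def by (intro continuous_intros) simp
  have "(\<integral>y. f y \<partial>\<mu>) = 0"
  proof (rule integral_eq_0_if_vanishing_off_Bad_const[OF borel_finite_measure_on_axioms decay(1) a decay(2) f])
    show "f y = 0" if "y \<in> K" "y \<notin> Bad_const (1 / real (Suc j))" for y
    proof -
      have "y \<notin> ball x r"
        using sub that by blast
      then show ?thesis
        by (simp add: f_def dist_commute)
    qed
  qed simp
  moreover have "0 < (\<integral>y. f y \<partial>\<mu>)"
    using f x by (intro integral_pos_if_pos_on_support[of f x]) (simp_all add: K_def f_def)
  ultimately show False
    by simp
qed

theorem theorem2:
  shows "fourier_dim (Bad :: (real ^ 'n) set)
           \<le> ennreal (2 * real CARD('n) / (real CARD('n) + 1))"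
  unfolding fourier_dim_def
proof (intro SUP_least ennreal_leI fourier_dim_measure_le)
  fix \<mu> :: "(real ^ 'n) measure" assume \<mu>: "\<mu> \<in> compact_prob_measures Bad"
  then show "prob_space \<mu>"
    by (simp add: compact_prob_measures_def)
  fix C s assume s: "s \<le> real CARD('n)" "fourier_decay C (s / 2) \<mu>"
  have "0 < real CARD('n)"
    by simp
  with s(1) have "s / 2 < real CARD('n)"
    by linarith
  with \<mu> s(2) have "s / 2 \<le> real CARD('n) / (real CARD('n) + 1)"
    by (intro fourier_decay_exponent_le)
  then show "s \<le> 2 * real CARD('n) / (real CARD('n) + 1)"
    by (simp add: mult.commute)
qed

end
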